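(* Let $(X_i)_{i\ge 1}$ be a sequence of i.i.d. real random variables on a probability space with mean $\mu$ and finite variance $\sigma^2>0$. Let $f:\mathbb{R}\to\mathbb{R}$ be a bounded, continuous function, and let $Y$ be a standard normal random variable. Then, for each $\epsilon>0$, there exists $n_1\in\mathbb{N}$ such that for all $n\ge n_1$, \[ \left|E\left(f\left(\frac{X_1+\cdots+X_n-n\mu}{\sigma\sqrt{n}}\right)\right)-E(f(Y))\right|<\epsilon\,(9\|f\|_\infty+2). \]
   Context: $\|f\|_\infty=\sup_{x\in\mathbb{R}}|f(x)|$, $\sigma>0$ is the standard deviation of $X_1$, and $E$ denotes expectation. *)

theory Defs
  imports "HOL-Probability.Probability"
begin

definition sup_norm :: "(real \<Rightarrow> real) \<Rightarrow> real" where
  "sup_norm f = (SUP x. \<bar>f x\<bar>)"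

end

theory Submission
  imports Defs
begin

text \<open>
  The bound contains the arbitrary factor \<open>\<epsilon>\<close> and the positive constant \<open>9 * sup_norm f + 2\<close>, so
  the assertion is qualitative: the expectations of \<open>f\<close> at the standardised partial sums converge
  to the expectation of \<open>f\<close> at a standard normal variable. By the central limit theorem the laws of
  the standardised sums converge weakly to the standard normal law, and by the portmanteau theorem
  weak convergence carries over to integrals of bounded continuous functions. The change of
  variables formula turns these integrals into the two expectations. One bookkeeping step
  connects the indices: \<open>central_limit_theorem\<close> concerns families over all natural
  numbers starting at 0, so it is applied to the shifted family \<open>\<lambda>i. X (Suc i)\<close>; the lemma
  \<open>indep_vars_reindex_inj\<close> says that shifting preserves independence.
\<close>

lemma sup_norm_nonneg:
  assumes "bounded (range f)"
  shows "0 \<le> sup_norm f"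
proof -
  from assms obtain B where "\<And>x. \<bar>f x\<bar> \<le> B"
    unfolding bounded_iff by auto
  then have "\<bar>f 0\<bar> \<le> sup_norm f"
    unfolding sup_norm_def by (intro cSUP_upper bdd_aboveI2) auto
  then show ?thesis
    using abs_ge_zero order_trans by blast
qed

text \<open>
  Independence is a product formula over finite index sets. Injectivity of \<open>h\<close> ensures that
  distinct new indices name distinct old variables, so that each product over a finite set of new
  indices is the product over its image.
\<close>

lemma (in prob_space) indep_vars_reindex_inj:
  assumes indep: "indep_vars N X (h ` I)" and inj: "inj_on h I"
  shows "indep_vars (\<lambda>i. N (h i)) (\<lambda>i. X (h i)) I"
proof -
  define F where "F i = {X i -` A \<inter> space M | A. A \<in> sets (N i)}" for i
  have F: "indep_sets F (h ` I)"
    using indep unfolding indep_vars_def2 F_def by simp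
  have "indep_sets (\<lambda>i. F (h i)) I"
  proof (rule indep_setsI)
    show "F (h i) \<subseteq> events" if "i \<in> I" for i
      using F that unfolding indep_sets_def by auto
  next
    fix A J
    assume J: "J \<noteq> {}" "J \<subseteq> I" "finite J" "\<forall>j\<in>J. A j \<in> F (h j)"
    define B where "B = (\<lambda>k. A (the_inv_into J h k))"
    have injJ: "inj_on h J"
      using inj J(2) by (rule inj_on_subset)
    have B: "B (h j) = A j" if "j \<in> J" for j
      using the_inv_into_f_f[OF injJ that] by (simp add: B_def)
    have "prob (\<Inter>k\<in>h ` J. B k) = (\<Prod>k\<in>h ` J. prob (B k))"
      using J B by (intro indep_setsD[OF F]) auto
    then show "prob (\<Inter>j\<in>J. A j) = (\<Prod>j\<in>J. prob (A j))"
      by (simp add: prod.reindex[OF injJ] B)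
  qed
  then show ?thesis
    using indep unfolding indep_vars_def2 F_def by simp
qed

text \<open>
  The central limit theorem yields convergence of distribution functions. The portmanteau theorem
  upgrades this to convergence of integrals against the laws, which are expectations of \<open>f\<close>
  at the standardised sums.
\<close>

lemma (in prob_space) central_limit_theorem_expectation:
  fixes X :: "nat \<Rightarrow> 'a \<Rightarrow> real" and f :: "real \<Rightarrow> real"
  assumes indep: "indep_vars (\<lambda>i. borel) X UNIV"
    and mean: "\<And>n. expectation (X n) = m"
    and pos: "\<sigma> > 0"
    and sq: "\<And>n. integrable M (\<lambda>x. (X n x)\<^sup>2)"
    and var: "\<And>n. variance (X n) = \<sigma>\<^sup>2"
    and distr: "\<And>n. distr M borel (X n) = \<nu>"
    and bounded: "bounded (range f)"
    and cont: "continuous_on UNIV f"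
  shows "(\<lambda>n. expectation (\<lambda>x. f (((\<Sum>i<n. X i x) - real n * m) / (\<sigma> * sqrt (real n)))))
    \<longlonglongrightarrow> integral\<^sup>L std_normal_distribution f"
proof -
  have rv [measurable]: "random_variable borel (X n)" for n
    using indep unfolding indep_vars_def2 by simp
  have f [measurable]: "f \<in> borel_measurable borel"
    using cont by (rule borel_measurable_continuous_onI)
  obtain B where B: "\<And>x. norm (f x) \<le> B"
    using bounded unfolding bounded_iff by auto
  define S where "S n x = (\<Sum>i<n. X i x - m) / sqrt (real n * \<sigma>\<^sup>2)" for n x
  have S_rv [measurable]: "random_variable borel (S n)" for n
    unfolding S_def by measurable
  have S_eq: "S n x = ((\<Sum>i<n. X i x) - real n * m) / (\<sigma> * sqrt (real n))" for n x
    using pos by (simp add: S_def sum_subtractf real_sqrt_mult mult.commute)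
  have "weak_conv_m (\<lambda>n. distr M borel (S n)) std_normal_distribution"
    unfolding S_def using central_limit_theorem[OF indep mean pos sq var distr] .
  then have "(\<lambda>n. integral\<^sup>L (distr M borel (S n)) f) \<longlonglongrightarrow> integral\<^sup>L std_normal_distribution f"
    using cont B
    by (intro weak_conv_imp_integral_bdd_continuous_conv[where B = B]
          real_distribution_distr real_dist_normal_dist)
       (auto simp: continuous_on_eq_continuous_at)
  then show ?thesis
    by (simp add: integral_distr S_eq)
qed

theorem theorem2:
  fixes M :: "'a measure" and X :: "nat \<Rightarrow> 'a \<Rightarrow> real"
    and N :: "'b measure" and Y :: "'b \<Rightarrow> real"
    and \<mu> \<sigma> :: real and f :: "real \<Rightarrow> real"
  assumes "prob_space M"
    and "prob_space.indep_vars M (\<lambda>i. borel) X {1..}"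
    and "\<And>i. i \<ge> 1 \<Longrightarrow> distr M borel (X i) = distr M borel (X 1)"
    and "integrable M (X 1)"
    and "prob_space.expectation M (X 1) = \<mu>"
    and "integrable M (\<lambda>\<omega>. (X 1 \<omega>)\<^sup>2)"
    and "prob_space.variance M (X 1) = \<sigma>\<^sup>2"
    and "\<sigma> > 0"
    and "bounded (range f)"
    and "continuous_on UNIV f"
    and "prob_space N"
    and "distributed N lborel Y std_normal_density"
  shows "\<forall>\<epsilon>>0. \<exists>n1::nat. n1 \<ge> 1 \<and> (\<forall>n\<ge>n1.
    \<bar>prob_space.expectation M (\<lambda>\<omega>. f (((\<Sum>i=1..n. X i \<omega>) - real n * \<mu>) / (\<sigma> * sqrt (real n))))
      - prob_space.expectation N (\<lambda>\<omega>. f (Y \<omega>))\<bar> < \<epsilon> * (9 * sup_norm f + 2))"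
proof (intro allI impI)
  fix \<epsilon> :: real
  assume \<epsilon>: "\<epsilon> > 0"
  interpret M: prob_space M by fact
  have f [measurable]: "f \<in> borel_measurable borel"
    using \<open>continuous_on UNIV f\<close> by (rule borel_measurable_continuous_onI)
  define Z where "Z i = X (Suc i)" for i
  have "Suc ` UNIV = {1..}"
    by (auto simp: image_iff Suc_le_eq gr0_conv_Suc)
  then have indep: "M.indep_vars (\<lambda>i. borel) Z UNIV"
    using M.indep_vars_reindex_inj[of "\<lambda>i. borel" X Suc UNIV] assms(2) by (simp add: Z_def[abs_def])
  have Z_rv: "M.random_variable borel (Z i)" for i
    using indep unfolding M.indep_vars_def2 by simp
  have X1_rv: "M.random_variable borel (X 1)"
    using \<open>integrable M (X 1)\<close> by (rule borel_measurable_integrable)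
  have distr: "distr M borel (Z i) = distr M borel (X 1)" for i
    unfolding Z_def by (rule assms(3)) simp
  \<comment> \<open>Mean, second moment and variance are functions of the law alone.\<close>
  have transfer_integral: "M.expectation (\<lambda>x. g (Z i x)) = M.expectation (\<lambda>x. g (X 1 x))"
    if g: "g \<in> borel_measurable borel" for g :: "real \<Rightarrow> real" and i
    using integral_distr[OF Z_rv g] integral_distr[OF X1_rv g] unfolding distr by (rule trans[OF sym])
  have transfer_integrable: "integrable M (\<lambda>x. g (Z i x)) \<longleftrightarrow> integrable M (\<lambda>x. g (X 1 x))"
    if g: "g \<in> borel_measurable borel" for g :: "real \<Rightarrow> real" and i
    using integrable_distr_eq[OF Z_rv g] integrable_distr_eq[OF X1_rv g] unfolding distr
    by (rule trans[OF sym])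
  have mean: "M.expectation (Z i) = \<mu>" for i
    using transfer_integral[of "\<lambda>x. x" i] assms(5) by simp
  have sq: "integrable M (\<lambda>x. (Z i x)\<^sup>2)" for i
    using transfer_integrable[of "\<lambda>x. x\<^sup>2" i] assms(6) by simp
  have var: "M.variance (Z i) = \<sigma>\<^sup>2" for i
    using transfer_integral[of "\<lambda>x. (x - \<mu>)\<^sup>2" i] assms(5,7) mean[of i] by simp
  have "(\<integral>\<omega>. f (Y \<omega>) \<partial>N) = (\<integral>x. std_normal_density x * f x \<partial>lborel)"
    using distributed_integral[OF assms(12), of f] by simp
  also have "\<dots> = integral\<^sup>L std_normal_distribution f"
    by (simp add: integral_density)
  finally have normal: "(\<integral>\<omega>. f (Y \<omega>) \<partial>N) = integral\<^sup>L std_normal_distribution f" .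
  have shift: "(\<Sum>i<n. Z i \<omega>) = (\<Sum>i=1..n. X i \<omega>)" for n \<omega>
    by (simp add: Z_def sum.atLeast1_atMost_eq)
  have lim: "(\<lambda>n. M.expectation
      (\<lambda>\<omega>. f (((\<Sum>i=1..n. X i \<omega>) - real n * \<mu>) / (\<sigma> * sqrt (real n)))))
    \<longlonglongrightarrow> (\<integral>\<omega>. f (Y \<omega>) \<partial>N)"
    using M.central_limit_theorem_expectation[OF indep mean assms(8) sq var distr assms(9,10)]
    by (simp add: shift normal)
  have "0 < \<epsilon> * (9 * sup_norm f + 2)"
    using \<epsilon> sup_norm_nonneg[OF assms(9)] by simp
  from LIMSEQ_D[OF lim this] obtain n0 where n0: "\<forall>n\<ge>n0.
    \<bar>M.expectation (\<lambda>\<omega>. f (((\<Sum>i=1..n. X i \<omega>) - real n * \<mu>) / (\<sigma> * sqrt (real n))))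
      - (\<integral>\<omega>. f (Y \<omega>) \<partial>N)\<bar> < \<epsilon> * (9 * sup_norm f + 2)"
    by auto
  then show "\<exists>n1::nat. n1 \<ge> 1 \<and> (\<forall>n\<ge>n1.
    \<bar>M.expectation (\<lambda>\<omega>. f (((\<Sum>i=1..n. X i \<omega>) - real n * \<mu>) / (\<sigma> * sqrt (real n))))
      - (\<integral>\<omega>. f (Y \<omega>) \<partial>N)\<bar> < \<epsilon> * (9 * sup_norm f + 2))"
    by (intro exI[of _ "max 1 n0"]) auto
qed

end
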